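(* Let $(L,[\cdot,\cdot])$ be a Lie superalgebra over a field $k$, and let $\alpha,\beta:L\to L$ be two commuting even algebra homomorphisms of $L$ (that is, even linear maps with $\alpha\circ\beta=\beta\circ\alpha$, $\alpha[x,y]=[\alpha(x),\alpha(y)]$ and $\beta[x,y]=[\beta(x),\beta(y)]$ for all $x,y\in L$). Define $$[x,y]_{\alpha,\beta}=[\alpha(x),\beta(y)],\qquad x,y\in L.$$ Then $(L,[\cdot,\cdot]_{\alpha,\beta},\alpha,\beta)$ is a BiHom-Lie superalgebra.
   Context: All spaces are over a field $k$. A superspace is a $\mathbb{Z}_2$-graded vector space $V=V_0\oplus V_1$; elements of $V_j$ are homogeneous of parity $j$, and the parity of a homogeneous $x$ is denoted $|x|$. A linear map is even if it preserves the grading; a bilinear map $V\otimes V\to V$ is even if it maps $V_i\otimes V_j$ to $V_{i+j}$ (indices mod 2). The symbol $\circlearrowleft_{x,y,z}$ denotes the sum over the cyclic permutations of $(x,y,z)$. A Lie superalgebra is a superspace $L$ with an even bilinear bracket satisfying, for homogeneous $x,y,z$, $[x,y]=-(-1)^{|x||y|}[y,x]$ and $\circlearrowleft_{x,y,z}(-1)^{|x||z|}[x,[y,z]]=0$. A BiHom-Lie superalgebra is a 4-tuple $(L,[\cdot,\cdot],\alpha,\beta)$ where $L$ is a superspace, $\alpha,\beta:L\to L$ are even linear maps and $[\cdot,\cdot]:L\otimes L\to L$ is an even bilinear map such that for all homogeneous $x,y,z\in L$: $\alpha\circ\beta=\beta\circ\alpha$; $\alpha[x,y]=[\alpha(x),\alpha(y)]$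 and $\beta[x,y]=[\beta(x),\beta(y)]$; $[\beta(x),\alpha(y)]=-(-1)^{|x||y|}[\beta(y),\alpha(x)]$; and $\circlearrowleft_{x,y,z}(-1)^{|x||z|}[\beta^{2}(x),[\beta(y),\alpha(z)]]=0$. *)

theory Defs
  imports Complex_Main "HOL-Library.Z2"
begin

text \<open>
  The underlying vector space is a whole type with scalar multiplication \<open>scale\<close>; \<open>V 0\<close> and \<open>V 1\<close>
  are its even and odd parts, the parities 0, 1 being elements of the two-element field \<open>bit\<close>.
  The zero vector is homogeneous of both parities, so there is no parity function on vectors:
  an identity for homogeneous \<open>x\<close>, \<open>y\<close> is stated for all parities \<open>i\<close>, \<open>j\<close> with \<open>x \<in> V i\<close>, \<open>y \<in> V j\<close>.
\<close>

locale superspace = vector_space scale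
  for scale :: "'k::field \<Rightarrow> 'v::ab_group_add \<Rightarrow> 'v" +
  fixes V :: "bit \<Rightarrow> 'v set"
  assumes subspace_part: "subspace (V i)"
    and parts_span: "\<exists>a\<in>V 0. \<exists>b\<in>V 1. v = a + b"
    and parts_disjoint: "V 0 \<inter> V 1 = {0}"

definition even_linear ::
    "('k::field \<Rightarrow> 'v::ab_group_add \<Rightarrow> 'v) \<Rightarrow> (bit \<Rightarrow> 'v set) \<Rightarrow> ('v \<Rightarrow> 'v) \<Rightarrow> bool" where
  "even_linear scale V f \<longleftrightarrow>
     Vector_Spaces.linear scale scale f \<and> (\<forall>i. \<forall>x\<in>V i. f x \<in> V i)"

definition even_bilinear ::
    "('k::field \<Rightarrow> 'v::ab_group_add \<Rightarrow> 'v) \<Rightarrow> (bit \<Rightarrow> 'v set) \<Rightarrow> ('v \<Rightarrow> 'v \<Rightarrow> 'v) \<Rightarrow> bool" where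
  "even_bilinear scale V b \<longleftrightarrow>
     (\<forall>x. Vector_Spaces.linear scale scale (\<lambda>y. b x y)) \<and>
     (\<forall>y. Vector_Spaces.linear scale scale (\<lambda>x. b x y)) \<and>
     (\<forall>i j. \<forall>x\<in>V i. \<forall>y\<in>V j. b x y \<in> V (i + j))"

text \<open>\<open>ksign i j\<close> is the sign $(-1)^{ij}$ as a scalar.\<close>

definition ksign :: "bit \<Rightarrow> bit \<Rightarrow> 'k::field" where
  "ksign i j = (if i * j = 0 then 1 else - 1)"

locale lie_superalgebra = superspace scale L
  for scale :: "'k::field \<Rightarrow> 'v::ab_group_add \<Rightarrow> 'v" and L :: "bit \<Rightarrow> 'v set" +
  fixes br :: "'v \<Rightarrow> 'v \<Rightarrow> 'v"
  assumes br_even_bilinear: "even_bilinear scale L br"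
    and super_skew: "\<lbrakk>x \<in> L i; y \<in> L j\<rbrakk> \<Longrightarrow> br x y = - scale (ksign i j) (br y x)"
    and super_jacobi: "\<lbrakk>x \<in> L i; y \<in> L j; z \<in> L l\<rbrakk> \<Longrightarrow>
      scale (ksign i l) (br x (br y z)) +
      scale (ksign j i) (br y (br z x)) +
      scale (ksign l j) (br z (br x y)) = 0"

locale bihom_lie_superalgebra = superspace scale L
  for scale :: "'k::field \<Rightarrow> 'v::ab_group_add \<Rightarrow> 'v" and L :: "bit \<Rightarrow> 'v set" +
  fixes br :: "'v \<Rightarrow> 'v \<Rightarrow> 'v" and \<alpha> \<beta> :: "'v \<Rightarrow> 'v"
  assumes alpha_even_linear: "even_linear scale L \<alpha>"
    and beta_even_linear: "even_linear scale L \<beta>"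
    and br_even_bilinear: "even_bilinear scale L br"
    and commute: "\<alpha> \<circ> \<beta> = \<beta> \<circ> \<alpha>"
    and alpha_br: "\<lbrakk>x \<in> L i; y \<in> L j\<rbrakk> \<Longrightarrow> \<alpha> (br x y) = br (\<alpha> x) (\<alpha> y)"
    and beta_br: "\<lbrakk>x \<in> L i; y \<in> L j\<rbrakk> \<Longrightarrow> \<beta> (br x y) = br (\<beta> x) (\<beta> y)"
    and bihom_super_skew: "\<lbrakk>x \<in> L i; y \<in> L j\<rbrakk> \<Longrightarrow>
      br (\<beta> x) (\<alpha> y) = - scale (ksign i j) (br (\<beta> y) (\<alpha> x))"
    and bihom_super_jacobi: "\<lbrakk>x \<in> L i; y \<in> L j; z \<in> L l\<rbrakk> \<Longrightarrow>
      scale (ksign i l) (br (\<beta> (\<beta> x)) (br (\<beta> y) (\<alpha> z))) +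
      scale (ksign j i) (br (\<beta> (\<beta> y)) (br (\<beta> z) (\<alpha> x))) +
      scale (ksign l j) (br (\<beta> (\<beta> z)) (br (\<beta> x) (\<alpha> y))) = 0"

end

theory Submission
  imports Defs
begin

text \<open>
  Since \<open>\<alpha>\<close> and \<open>\<beta>\<close> commute and respect the bracket, the BiHom identities for
  \<open>x\<close>, \<open>y\<close>, \<open>z\<close> are the Lie identities at the images of \<open>x\<close>, \<open>y\<close>, \<open>z\<close> under \<open>\<alpha>\<beta>\<close>
  (skew symmetry) and under \<open>\<alpha>\<beta>\<^sup>2\<close> (Jacobi).
\<close>

theorem theorem2p7:
  fixes scale :: "'k::field \<Rightarrow> 'v::ab_group_add \<Rightarrow> 'v"
    and L :: "bit \<Rightarrow> 'v set"
    and br :: "'v \<Rightarrow> 'v \<Rightarrow> 'v"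
    and \<alpha> \<beta> :: "'v \<Rightarrow> 'v"
  assumes "lie_superalgebra scale L br"
    and "even_linear scale L \<alpha>"
    and "even_linear scale L \<beta>"
    and "\<alpha> \<circ> \<beta> = \<beta> \<circ> \<alpha>"
    and "\<And>x y. \<alpha> (br x y) = br (\<alpha> x) (\<alpha> y)"
    and "\<And>x y. \<beta> (br x y) = br (\<beta> x) (\<beta> y)"
  shows "bihom_lie_superalgebra scale L (\<lambda>x y. br (\<alpha> x) (\<beta> y)) \<alpha> \<beta>"
proof -
  interpret lie_superalgebra scale L br by fact
  have comm: "\<beta> (\<alpha> x) = \<alpha> (\<beta> x)" for x
    using fun_cong[OF assms(4), of x] by simp
  have lin_\<alpha>: "Vector_Spaces.linear scale scale \<alpha>" and \<alpha>_in: "x \<in> L i \<Longrightarrow> \<alpha> x \<in> L i" for x i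
    using assms(2) by (auto simp: even_linear_def)
  have lin_\<beta>: "Vector_Spaces.linear scale scale \<beta>" and \<beta>_in: "x \<in> L i \<Longrightarrow> \<beta> x \<in> L i" for x i
    using assms(3) by (auto simp: even_linear_def)
  have lin_r: "Vector_Spaces.linear scale scale (\<lambda>y. br x y)"
    and lin_l: "Vector_Spaces.linear scale scale (\<lambda>x. br x y)"
    and br_in: "\<lbrakk>x \<in> L i; y \<in> L j\<rbrakk> \<Longrightarrow> br x y \<in> L (i + j)" for x y i j
    using br_even_bilinear by (auto simp: even_bilinear_def)
  show ?thesis
  proof
    \<comment> \<open>In each slot the new bracket is a partial map of \<open>br\<close> composed
      with \<open>\<alpha>\<close> or \<open>\<beta>\<close>, both of which keep parity.\<close>
    show "even_bilinear scale L (\<lambda>x y. br (\<alpha> x) (\<beta> y))"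
      unfolding even_bilinear_def
      using Vector_Spaces.linear_compose[OF lin_\<beta> lin_r] Vector_Spaces.linear_compose[OF lin_\<alpha> lin_l]
      by (intro conjI allI ballI br_in \<alpha>_in \<beta>_in) (simp_all add: o_def)
  next
    fix x y i j assume "x \<in> L i" "y \<in> L j"
    then show "br (\<alpha> (\<beta> x)) (\<beta> (\<alpha> y)) = - scale (ksign i j) (br (\<alpha> (\<beta> y)) (\<beta> (\<alpha> x)))"
      unfolding comm by (intro super_skew \<alpha>_in \<beta>_in)
  next
    fix x y z i j l assume "x \<in> L i" "y \<in> L j" "z \<in> L l"
    then show "scale (ksign i l) (br (\<alpha> (\<beta> (\<beta> x))) (\<beta> (br (\<alpha> (\<beta> y)) (\<beta> (\<alpha> z))))) +
      scale (ksign j i) (br (\<alpha> (\<beta> (\<beta> y))) (\<beta> (br (\<alpha> (\<beta> z)) (\<beta> (\<alpha> x))))) +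
      scale (ksign l j) (br (\<alpha> (\<beta> (\<beta> z))) (\<beta> (br (\<alpha> (\<beta> x)) (\<beta> (\<alpha> y))))) = 0"
      \<comment> \<open>\<open>\<beta>\<close> first enters the inner bracket; then
        \<open>comm\<close> moves every \<open>\<alpha>\<close> outermost, so each argument takes
        the form \<open>\<alpha> (\<beta> (\<beta> u))\<close>, with the parity, hence the signs, of
        \<open>u\<close>.\<close>
      unfolding assms(6) comm by (intro super_jacobi \<alpha>_in \<beta>_in)
  \<comment> \<open>Among the remaining goals, multiplicativity of \<open>\<alpha>\<close> needs
    \<open>comm\<close> in the second slot, that of \<open>\<beta>\<close> in the first.\<close>
  qed (use assms comm in auto)
qed

end
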